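(* Let $G$ be a compact and metrizable topological abelian group, equipped with its Borel $\sigma$-algebra. Assume that $G$ has no open subgroups except $G$ itself and possibly $\{0\}$. Let $X,Y$ be independent random variables on $G$ with finite entropies. Then $$h(X+Y)-\frac{1}{2}h(X)-\frac{1}{2}h(Y) \geq 0.$$ Moreover: (i) If $G$ is connected, then there is equality if and only if $X$ and $Y$ are both uniform on $G$. (ii) If $G$ is finite, then there is equality if and only if either both $X$ and $Y$ are uniform on the whole group $G$ or both $X$ and $Y$ are deterministic.
   Context: Let $\mu$ be the unique Haar probability measure on $G$. For a $G$-valued random variable $X$, the entropy is $h(X):=-\int_G f\log f\,d\mu$ if the law of $X$ has a density $f$ with respect to $\mu$, and $h(X):=-\infty$ otherwise ($\log$ is the natural logarithm); one always has $h(X)\in[-\infty,0]$. "Finite entropy" means $h(X)>-\infty$. "Uniform on $G$" means having law $\mu$. "Deterministic" means almost surely equal to a constant. *)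

theory Defs
  imports "HOL-Probability.Probability"
begin

definition add_subgroup :: "'g::group_add set \<Rightarrow> bool" where
  "add_subgroup H \<longleftrightarrow> 0 \<in> H \<and> (\<forall>x\<in>H. \<forall>y\<in>H. x + y \<in> H) \<and> (\<forall>x\<in>H. - x \<in> H)"

(* On a compact metrizable group every finite Borel measure is regular, so regularity is not
   demanded separately. For an abelian group one-sided invariance is enough. *)
definition haar_prob_measure :: "'g::topological_ab_group_add measure \<Rightarrow> bool" where
  "haar_prob_measure \<mu> \<longleftrightarrow>
     sets \<mu> = sets borel \<and> prob_space \<mu> \<and> (\<forall>a. distr \<mu> borel (\<lambda>x. a + x) = \<mu>)"

(* The integral of g as an extended real: positive part minus negative part, where ennreal
   truncates negative reals to 0. It is meaningful whenever one of the two parts is finite. *)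
definition ext_integral :: "'a measure \<Rightarrow> ('a \<Rightarrow> real) \<Rightarrow> ereal" where
  "ext_integral M g =
     enn2ereal (\<integral>\<^sup>+ x. ennreal (g x) \<partial>M) - enn2ereal (\<integral>\<^sup>+ x. ennreal (- g x) \<partial>M)"

(* RN_deriv picks a density whenever one exists, without any further hypothesis. The negative
   part of f * ln f is at most exp (-1), so its integral is finite for a probability measure;
   the convention 0 * ln 0 = 0 is automatic. The constant entropy of HOL-Probability is
   real-valued and so cannot take the value - \<infinity>. *)
definition haar_entropy ::
  "'g::topological_space measure \<Rightarrow> 'w measure \<Rightarrow> ('w \<Rightarrow> 'g) \<Rightarrow> ereal" where
  "haar_entropy \<mu> P X =
     (if \<exists>f. f \<in> borel_measurable \<mu> \<and> density \<mu> f = distr P borel X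
      then - ext_integral \<mu>
               (\<lambda>x. let f = enn2real (RN_deriv \<mu> (distr P borel X) x) in f * ln f)
      else - \<infinity>)"

definition haar_uniform ::
  "'g::topological_space measure \<Rightarrow> 'w measure \<Rightarrow> ('w \<Rightarrow> 'g) \<Rightarrow> bool" where
  "haar_uniform \<mu> P X \<longleftrightarrow> distr P borel X = \<mu>"

definition deterministic :: "'w measure \<Rightarrow> ('w \<Rightarrow> 'g) \<Rightarrow> bool" where
  "deterministic P X \<longleftrightarrow> (\<exists>c. AE w in P. X w = c)"

end

theory Submission
  imports Defs
begin

text \<open>Let \<open>X\<close> and \<open>Y\<close> have laws \<open>p\<close>, \<open>q\<close> and let \<open>p\<close> have density \<open>f\<close>. Then \<open>X + Y\<close> has density
  \<open>k z = \<integral> f (z - y) dq(y)\<close>, so by Jensen's inequality and translation invariance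
  \<open>h (X + Y) \<ge> h X\<close>, and by symmetry \<open>h (X + Y) \<ge> h Y\<close>; averaging the two gives the inequality.
  In the case of equality, strict convexity forces \<open>f (z - y) = k z\<close> almost everywhere, that is, for
  \<open>q\<close>-almost every \<open>y\<close> the translate of \<open>p\<close> by \<open>y\<close> is the law of \<open>X + Y\<close>. Hence \<open>q\<close> lives on a coset of
  the stabilizer \<open>H\<close> of \<open>p\<close>. As \<open>q\<close> has a density, the closed subgroup \<open>H\<close> has positive Haar measure and is
  therefore open. If \<open>H\<close> is the whole group, then \<open>p\<close> is the Haar measure; if \<open>H = {0}\<close>, then \<open>Y\<close> is
  deterministic.\<close>

section \<open>Countable bases and measurability on products\<close>

text \<open>Compactness gives total boundedness, and the balls of radius \<open>1 / (n + 1)\<close>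
  around finite nets form the basis. It later makes the group operations measurable.\<close>

lemma compact_metrizable_countable_basis:
  assumes "compact (UNIV :: 'a::topological_space set)"
    and "metrizable_space (euclidean :: 'a::topological_space topology)"
  obtains B :: "'a::topological_space set set" where "countable B" "topological_basis B"
proof -
  obtain M and d :: "'a \<Rightarrow> 'a \<Rightarrow> real" where M: "Metric_space M d"
    and eq: "(euclidean :: 'a topology) = Metric_space.mtopology M d"
    using assms(2) unfolding metrizable_space_def by blast
  have MU: "M = UNIV"
    using Metric_space.topspace_mtopology[OF M] unfolding eq[symmetric] by simp
  interpret Metric_space UNIV d using M unfolding MU .
  have op: "openin mtopology U \<longleftrightarrow> open U" for U
    using eq unfolding MU by (metis open_openin)
  have "compactin mtopology UNIV"
    using assms(1) eq unfolding MU by (metis compactin_euclidean_iff)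
  then have "mtotally_bounded UNIV"
    by (rule compactin_imp_mtotally_bounded)
  then have "\<exists>K. finite K \<and> UNIV \<subseteq> (\<Union>x\<in>K. mball x (1 / real (Suc n)))" for n
    unfolding mtotally_bounded_def by (metis of_nat_0_less_iff zero_less_Suc zero_less_divide_1_iff)
  then obtain K where K: "\<And>n. finite (K n)" "\<And>n. UNIV \<subseteq> (\<Union>x\<in>K n. mball x (1 / real (Suc n)))"
    by metis
  let ?B = "\<Union>n. (\<lambda>x. mball x (1 / real (Suc n))) ` K n"
  have "countable ?B" using K(1) by (intro countable_UN) (auto intro: countable_finite)
  moreover have "topological_basis ?B"
  proof (rule topological_basisI)
    show "open V" if "V \<in> ?B" for V
      using that by (auto simp flip: op)
    fix U :: "'a set" and x assume U: "open U" "x \<in> U"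
    then obtain r where r: "r > 0" "mball x r \<subseteq> U"
      using op openin_mtopology by (metis iso_tuple_UNIV_I)
    \<comment> \<open>The ball around the net point \<open>y\<close> has radius below
      \<open>r / 2\<close> and contains \<open>x\<close>, so all its points are within
      \<open>r\<close> of \<open>x\<close>.\<close>
    obtain n where n: "1 / real (Suc n) < r / 2"
      using r by (meson half_gt_zero nat_approx_posE)
    obtain y where y: "y \<in> K n" "x \<in> mball y (1 / real (Suc n))" using K(2)[of n] by blast
    have "mball y (1 / real (Suc n)) \<subseteq> mball x r"
    proof
      fix z assume "z \<in> mball y (1 / real (Suc n))"
      then show "z \<in> mball x r"
        using y n triangle[of x y z] commute[of x y] by (auto simp: in_mball)
    qed
    then show "\<exists>V\<in>?B. x \<in> V \<and> V \<subseteq> U" using y r by blast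
  qed
  ultimately show ?thesis by (rule that)
qed

text \<open>Countable bases make every open set of the product a countable union of open rectangles,
  hence a member of the product sigma-algebra.\<close>

lemma borel_measurable_continuous_pair:
  fixes f :: "'a::topological_space \<times> 'b::topological_space \<Rightarrow> 'c::topological_space"
    and A :: "'a set set" and B :: "'b set set"
  assumes "countable A" "topological_basis A" "countable B" "topological_basis B"
    and "continuous_on UNIV f"
  shows "f \<in> borel \<Otimes>\<^sub>M borel \<rightarrow>\<^sub>M borel"
proof (rule borel_measurableI)
  fix U :: "'c set" assume "open U"
  let ?R = "(\<lambda>(a, b). a \<times> b) ` (A \<times> B)"
  have "open (f -` U)"
    using assms(5) \<open>open U\<close> by (simp add: open_vimage)
  then obtain R where R: "R \<subseteq> ?R" "\<Union>R = f -` U"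
    using topological_basis_prod[OF assms(2,4)] unfolding topological_basis_def by meson
  have "W \<in> sets (borel \<Otimes>\<^sub>M borel)" if W: "W \<in> R" for W
  proof -
    obtain a b where ab: "a \<in> A" "b \<in> B" "W = a \<times> b" using W R(1) by fastforce
    then have "a \<in> sets borel" "b \<in> sets borel"
      using topological_basis_open assms(2,4) by (blast intro: borel_open)+
    then show ?thesis using ab(3) by auto
  qed
  moreover have "countable R" by (rule countable_subset[OF R(1)]) (use assms(1,3) in auto)
  ultimately have "\<Union>R \<in> sets (borel \<Otimes>\<^sub>M borel)" by (intro sets.countable_Union) auto
  then show "f -` U \<inter> space (borel \<Otimes>\<^sub>M borel) \<in> sets (borel \<Otimes>\<^sub>M borel)"
    using R(2) by (simp add: space_pair_measure)
qed

section \<open>The convex function behind the entropy and its divergence\<close>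

text \<open>For a probability density \<open>f\<close>, the linear terms integrate to zero, so that the entropy
  is minus the integral of the nonnegative function \<open>ent_fun \<circ> f\<close>.\<close>

definition ent_fun :: "real \<Rightarrow> real" where
  "ent_fun t = t * ln t - t + 1"

text \<open>The Bregman divergence of \<open>ent_fun\<close>; the junk value \<open>ln 0 = 0\<close> makes it equal to \<open>s * ln s - s\<close>
  for \<open>t = 0\<close>, hence the restrictions to \<open>t > 0\<close> below.\<close>

definition ent_div :: "real \<Rightarrow> real \<Rightarrow> real" where
  "ent_div s t = s * ln s - s * ln t - s + t"

text \<open>This is \<open>ln u \<le> u - 1\<close> at \<open>u = t / s\<close>; for
  \<open>s = 0\<close> the value is \<open>t\<close>.\<close>

lemma ent_div_nonneg:
  assumes "s \<ge> 0" "t > 0"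
  shows "ent_div s t \<ge> 0"
proof (cases "s = 0")
  case False
  then have s: "s > 0" using assms by simp
  have "ln (t / s) \<le> t / s - 1" using s assms by (intro ln_le_minus_one) simp
  then have "s * (ln t - ln s) \<le> s * (t / s - 1)"
    using s assms by (intro mult_left_mono) (simp_all add: ln_div)
  then show ?thesis using s by (simp add: ent_div_def algebra_simps)
qed (use assms in \<open>simp add: ent_div_def\<close>)

text \<open>The equality case \<open>u = 1\<close> of \<open>ln u \<le> u - 1\<close>, again at
  \<open>u = t / s\<close>.\<close>

lemma ent_div_eq_0_iff:
  assumes "s \<ge> 0" "t > 0"
  shows "ent_div s t = 0 \<longleftrightarrow> s = t"
proof
  assume eq: "ent_div s t = 0"
  then have s: "s > 0" using assms by (cases "s = 0") (auto simp: ent_div_def)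
  have "s * (ln (t / s) - (t / s - 1)) = - ent_div s t"
    using s assms by (simp add: ent_div_def ln_div field_simps)
  then have "ln (t / s) = t / s - 1" using eq s by simp
  then have "t / s = 1" using s assms by (intro ln_eq_minus_one) auto
  then show "s = t" using s by simp
qed (simp add: ent_div_def)

lemma ent_fun_eq_ent_div: "ent_fun t = ent_div t 1"
  by (simp add: ent_fun_def ent_div_def)

lemma ent_fun_nonneg: "t \<ge> 0 \<Longrightarrow> ent_fun t \<ge> 0"
  by (simp add: ent_fun_eq_ent_div ent_div_nonneg)

lemma ent_fun_eq_0_iff: "t \<ge> 0 \<Longrightarrow> ent_fun t = 0 \<longleftrightarrow> t = 1"
  by (simp add: ent_fun_eq_ent_div ent_div_eq_0_iff)

lemma ent_fun_measurable [measurable]: "ent_fun \<in> borel_measurable borel"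
  unfolding ent_fun_def by measurable

lemma ent_div_measurable [measurable]:
  "f \<in> borel_measurable M \<Longrightarrow> g \<in> borel_measurable M \<Longrightarrow> (\<lambda>x. ent_div (f x) (g x)) \<in> borel_measurable M"
  unfolding ent_div_def by simp

section \<open>Entropy computed from a density\<close>

text \<open>The linear terms cancel because \<open>f\<close> and the constant 1 both have integral
  1. The integral of \<open>ent_fun\<close> may be infinite.\<close>

lemma ext_integral_density:
  fixes f :: "'a \<Rightarrow> real"
  assumes "prob_space M" and [measurable]: "f \<in> borel_measurable M" and f: "\<And>x. f x \<ge> 0"
    and "(\<integral>\<^sup>+ x. ennreal (f x) \<partial>M) = 1"
  shows "ext_integral M (\<lambda>x. f x * ln (f x)) = enn2ereal (\<integral>\<^sup>+ x. ennreal (ent_fun (f x)) \<partial>M)"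
proof -
  interpret prob_space M by fact
  let ?p = "\<integral>\<^sup>+ x. ennreal (f x * ln (f x)) \<partial>M" and ?n = "\<integral>\<^sup>+ x. ennreal (- (f x * ln (f x))) \<partial>M"
  let ?I = "\<integral>\<^sup>+ x. ennreal (ent_fun (f x)) \<partial>M"
  \<comment> \<open>Negative contributions are moved to the other side, so that only nonnegative
    terms are integrated.\<close>
  have *: "ennreal (f x * ln (f x)) + 1 = ennreal (ent_fun (f x)) + ennreal (f x) + ennreal (- (f x * ln (f x)))" for x
  proof (cases "f x * ln (f x) \<ge> 0")
    case True
    then show ?thesis using ent_fun_nonneg[OF f[of x]] f[of x]
      by (simp add: ennreal_neg flip: ennreal_plus ennreal_1) (simp add: ent_fun_def)
  next
    case False
    then show ?thesis using ent_fun_nonneg[OF f[of x]] f[of x]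
      by (simp add: ennreal_neg flip: ennreal_plus) (simp add: ent_fun_def)
  qed
  have "(\<integral>\<^sup>+ x. ennreal (f x * ln (f x)) + 1 \<partial>M) = ?p + 1"
    by (subst nn_integral_add) (auto simp: emeasure_space_1)
  moreover have "(\<integral>\<^sup>+ x. ennreal (ent_fun (f x)) + ennreal (f x) + ennreal (- (f x * ln (f x))) \<partial>M) = ?I + 1 + ?n"
    by (simp add: nn_integral_add assms(4))
  ultimately have sum: "?p + 1 = ?I + 1 + ?n" using * by simp
  \<comment> \<open>Nonnegativity of \<open>ent_fun\<close> gives
    \<open>f x * ln (f x) \<ge> f x - 1 \<ge> - 1\<close>. The negative part thus has a finite
    integral, which may be subtracted.\<close>
  have "- (f x * ln (f x)) \<le> 1" for x
    using ent_fun_nonneg[OF f[of x]] f[of x] by (simp add: ent_fun_def)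
  then have "?n \<le> (\<integral>\<^sup>+ x. 1 \<partial>M)" by (intro nn_integral_mono) (metis ennreal_1 ennreal_leI)
  then have n: "?n \<noteq> \<top>" by (auto simp: emeasure_space_1 top_unique)
  have "1 + ?p = 1 + (?I + ?n)" using sum by (simp only: ac_simps)
  then have "?p = ?I + ?n" unfolding ennreal_add_left_cancel by simp
  then have "enn2ereal ?p = enn2ereal ?I + enn2ereal ?n" by (simp add: plus_ennreal.rep_eq)
  moreover have "\<bar>enn2ereal ?n\<bar> \<noteq> \<infinity>" using n by (cases ?n) auto
  ultimately show ?thesis unfolding ext_integral_def
    by (cases "enn2ereal ?I"; cases "enn2ereal ?n") auto
qed

text \<open>Densities of the same law agree almost everywhere, so \<open>f\<close> may replace
  \<open>RN_deriv\<close>.\<close>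

lemma haar_entropy_density:
  assumes \<mu>: "prob_space \<mu>" and f[measurable]: "f \<in> borel_measurable \<mu>"
    and "distr P borel X = density \<mu> (\<lambda>x. ennreal (f x))" and nonneg: "\<And>x. f x \<ge> 0"
    and "prob_space P" "X \<in> P \<rightarrow>\<^sub>M borel"
  shows "haar_entropy \<mu> P X = - enn2ereal (\<integral>\<^sup>+ x. ennreal (ent_fun (f x)) \<partial>\<mu>)"
proof -
  interpret prob_space \<mu> by fact
  let ?N = "distr P borel X"
  interpret N: prob_space ?N using assms(5,6) by (rule prob_space.prob_space_distr)
  have [measurable]: "RN_deriv \<mu> ?N \<in> borel_measurable \<mu>" by (rule borel_measurable_RN_deriv)
  define g where "g x = enn2real (RN_deriv \<mu> ?N x)" for x
  have [measurable]: "g \<in> borel_measurable \<mu>" unfolding g_def by measurable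
  have "AE x in \<mu>. ennreal (f x) = RN_deriv \<mu> ?N x"
    using assms(3) by (intro RN_deriv_unique) auto
  then have ae: "AE x in \<mu>. f x = g x"
    by eventually_elim (metis enn2real_ennreal g_def nonneg)
  have "emeasure ?N (space ?N) = (\<integral>\<^sup>+ x. ennreal (f x) \<partial>\<mu>)"
    unfolding assms(3) by (subst emeasure_density) (auto intro!: nn_integral_cong)
  also have "\<dots> = (\<integral>\<^sup>+ x. ennreal (g x) \<partial>\<mu>)" using ae by (intro nn_integral_cong_AE) auto
  finally have "(\<integral>\<^sup>+ x. ennreal (g x) \<partial>\<mu>) = 1" using N.emeasure_space_1 by simp
  then have "ext_integral \<mu> (\<lambda>x. g x * ln (g x)) = enn2ereal (\<integral>\<^sup>+ x. ennreal (ent_fun (g x)) \<partial>\<mu>)"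
    using \<mu> by (intro ext_integral_density) (auto simp: g_def)
  also have "(\<integral>\<^sup>+ x. ennreal (ent_fun (g x)) \<partial>\<mu>) = (\<integral>\<^sup>+ x. ennreal (ent_fun (f x)) \<partial>\<mu>)"
    using ae by (intro nn_integral_cong_AE) auto
  finally have "ext_integral \<mu> (\<lambda>x. g x * ln (g x)) = enn2ereal (\<integral>\<^sup>+ x. ennreal (ent_fun (f x)) \<partial>\<mu>)" .
  moreover have "\<exists>f. f \<in> borel_measurable \<mu> \<and> density \<mu> f = ?N"
    using assms(3) by (intro exI[of _ "\<lambda>x. ennreal (f x)"]) simp
  ultimately show ?thesis unfolding haar_entropy_def Let_def g_def[symmetric] by simp
qed

lemma haar_entropy_finite_density:
  assumes \<mu>: "prob_space \<mu>" and "prob_space P" "X \<in> P \<rightarrow>\<^sub>M borel" and fin: "haar_entropy \<mu> P X > - \<infinity>"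
  obtains f :: "_ \<Rightarrow> real" where "f \<in> borel_measurable \<mu>" "\<And>x. f x \<ge> 0"
    "distr P borel X = density \<mu> (\<lambda>x. ennreal (f x))"
    "(\<integral>\<^sup>+ x. ennreal (ent_fun (f x)) \<partial>\<mu>) < \<infinity>"
proof -
  interpret prob_space \<mu> by fact
  interpret N: prob_space "distr P borel X" using assms(2,3) by (rule prob_space.prob_space_distr)
  obtain g where g[measurable]: "g \<in> borel_measurable \<mu>" and eq: "density \<mu> g = distr P borel X"
    using fin unfolding haar_entropy_def by (auto split: if_splits)
  have "(\<integral>\<^sup>+ x. g x \<partial>\<mu>) = emeasure (density \<mu> g) (space \<mu>)"
    by (subst emeasure_density) (auto intro!: nn_integral_cong)
  also have "\<dots> = emeasure (density \<mu> g) (space (density \<mu> g))" by simp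
  also have "\<dots> = 1" unfolding eq by (rule N.emeasure_space_1)
  \<comment> \<open>A density of total mass 1 is finite almost everywhere, so
    \<open>enn2real\<close> alters it on a null set only.\<close>
  finally have "AE x in \<mu>. g x \<noteq> \<infinity>" by (intro nn_integral_PInf_AE) auto
  then have "AE x in \<mu>. g x = ennreal (enn2real (g x))"
    by eventually_elim (simp add: less_top)
  then have eq': "distr P borel X = density \<mu> (\<lambda>x. ennreal (enn2real (g x)))"
    unfolding eq[symmetric] by (intro density_cong) auto
  have "haar_entropy \<mu> P X = - enn2ereal (\<integral>\<^sup>+ x. ennreal (ent_fun (enn2real (g x))) \<partial>\<mu>)"
    using assms(1-3) eq' by (intro haar_entropy_density) auto
  with fin have "(\<integral>\<^sup>+ x. ennreal (ent_fun (enn2real (g x))) \<partial>\<mu>) < \<infinity>"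
    by (auto simp: less_top)
  then show ?thesis using eq' by (intro that[of "\<lambda>x. enn2real (g x)"]) auto
qed

section \<open>Jensen's inequality for the entropy integrand\<close>

text \<open>The tangent identity
  \<open>ent_fun s = ent_fun t + ln t * (s - t) + ent_div s t\<close>, with \<open>ln t\<close>
  split into positive and negative part so that nothing is subtracted.\<close>

lemma ent_fun_split:
  "ent_fun s + max (ln t) 0 * t + max (- ln t) 0 * s
    = ent_fun t + max (ln t) 0 * s + max (- ln t) 0 * t + ent_div s t"
  by (simp add: ent_fun_def ent_div_def max_def algebra_simps)

text \<open>Jensen's inequality for \<open>ent_fun\<close> with its exact defect. The tangent line of \<open>ent_fun\<close> at \<open>t\<close>
  is split by the sign of its slope \<open>ln t\<close>, so that only nonnegative functions are integrated and no
  integrability is required.\<close>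

lemma nn_integral_ent_fun:
  assumes "prob_space M" and [measurable]: "s \<in> borel_measurable M" and s: "\<And>y. s y \<ge> 0"
    and "t \<ge> 0" and st: "(\<integral>\<^sup>+ y. ennreal (s y) \<partial>M) = ennreal t"
  shows "(\<integral>\<^sup>+ y. ennreal (ent_fun (s y)) \<partial>M)
      = ennreal (ent_fun t) + (\<integral>\<^sup>+ y. (if t > 0 then ennreal (ent_div (s y) t) else 0) \<partial>M)"
proof -
  interpret prob_space M by fact
  show ?thesis
  proof (cases "t > 0")
    \<comment> \<open>Here \<open>s\<close> vanishes almost everywhere and both sides equal
      \<open>ent_fun 0 = 1\<close>, the defect being set to 0.\<close>
    case False
    with \<open>t \<ge> 0\<close> have t: "t = 0" by simp
    with st have "(\<integral>\<^sup>+ y. ennreal (s y) \<partial>M) = 0" by simp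
    then have "AE y in M. s y = 0"
      using s by (subst (asm) nn_integral_0_iff_AE) (auto simp: order_antisym)
    then have "(\<integral>\<^sup>+ y. ennreal (ent_fun (s y)) \<partial>M) = (\<integral>\<^sup>+ y. ennreal (ent_fun 0) \<partial>M)"
      by (intro nn_integral_cong_AE) auto
    then show ?thesis using t by (simp add: emeasure_space_1)
  next
    case True
    define c d where "c = max (ln t) 0" and "d = max (- ln t) 0"
    have cd: "c \<ge> 0" "d \<ge> 0" by (auto simp: c_def d_def)
    let ?B = "\<integral>\<^sup>+ y. ennreal (ent_div (s y) t) \<partial>M"
    have "ennreal (ent_fun (s y)) + ennreal (c * t) + ennreal d * ennreal (s y)
      = ennreal (ent_fun t) + ennreal c * ennreal (s y) + ennreal (d * t) + ennreal (ent_div (s y) t)" for y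
      using ent_fun_split[of "s y" t, folded c_def d_def] cd \<open>t \<ge> 0\<close> s[of y]
        ent_fun_nonneg[OF s[of y]] ent_fun_nonneg[OF \<open>t \<ge> 0\<close>] ent_div_nonneg[OF s[of y] True]
      by (simp flip: ennreal_plus ennreal_mult)
    then have "(\<integral>\<^sup>+ y. ennreal (ent_fun (s y)) + ennreal (c * t) + ennreal d * ennreal (s y) \<partial>M)
      = (\<integral>\<^sup>+ y. ennreal (ent_fun t) + ennreal c * ennreal (s y) + ennreal (d * t) + ennreal (ent_div (s y) t) \<partial>M)"
      by simp
    then have "(\<integral>\<^sup>+ y. ennreal (ent_fun (s y)) \<partial>M) + ennreal (c * t) + ennreal (d * t)
      = ennreal (ent_fun t) + ennreal (c * t) + ennreal (d * t) + ?B"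
      using cd \<open>t \<ge> 0\<close> by (simp add: nn_integral_add nn_integral_cmult st emeasure_space_1 ennreal_mult)
    \<comment> \<open>The terms linear in \<open>s\<close> have integrated to finite constants, the
      same on both sides. They cancel even if the other integrals are infinite.\<close>
    then have "ennreal (c * t + d * t) + (\<integral>\<^sup>+ y. ennreal (ent_fun (s y)) \<partial>M)
      = ennreal (c * t + d * t) + (ennreal (ent_fun t) + ?B)"
      using cd \<open>t \<ge> 0\<close> by (simp add: ac_simps)
    then show ?thesis using True unfolding ennreal_add_left_cancel by simp
  qed
qed

text \<open>Strict convexity: a zero defect forces \<open>s\<close> to be constant. For
  \<open>t = 0\<close> this comes from the vanishing integral of \<open>s\<close>.\<close>

lemma nn_integral_ent_div_eq_0:
  assumes [measurable]: "s \<in> borel_measurable M" and s: "\<And>y. s y \<ge> 0"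
    and "t \<ge> 0" and st: "(\<integral>\<^sup>+ y. ennreal (s y) \<partial>M) = ennreal t"
    and zero: "(\<integral>\<^sup>+ y. (if t > 0 then ennreal (ent_div (s y) t) else 0) \<partial>M) = 0"
  shows "AE y in M. s y = t"
proof (cases "t > 0")
  case False
  with \<open>t \<ge> 0\<close> have t: "t = 0" by simp
  with st have "(\<integral>\<^sup>+ y. ennreal (s y) \<partial>M) = 0" by simp
  then show ?thesis
    using s t by (subst (asm) nn_integral_0_iff_AE) (auto simp: order_antisym)
next
  case True
  with zero have "AE y in M. ennreal (ent_div (s y) t) = 0"
    by (subst (asm) nn_integral_0_iff_AE) auto
  then show ?thesis
  proof eventually_elim
    case (elim y)
    then show ?case
      using ent_div_nonneg[OF s[of y] True] ent_div_eq_0_iff[OF s[of y] True] by (simp add: ennreal_eq_0_iff)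
  qed
qed

text \<open>Reduces closedness of stabilizers to sequences, where Fatou's lemma applies.\<close>

lemma metrizable_sequentially_closed:
  fixes S :: "'a::topological_space set"
  assumes "metrizable_space (euclidean :: 'a topology)"
    and "\<And>\<sigma> l. (\<And>n. \<sigma> n \<in> S) \<Longrightarrow> \<sigma> \<longlonglongrightarrow> l \<Longrightarrow> l \<in> S"
  shows "closed S"
proof -
  obtain M and d :: "'a \<Rightarrow> 'a \<Rightarrow> real" where M: "Metric_space M d"
    and eq: "(euclidean :: 'a topology) = Metric_space.mtopology M d"
    using assms(1) unfolding metrizable_space_def by blast
  have "M = UNIV"
    using Metric_space.topspace_mtopology[OF M] unfolding eq[symmetric] by simp
  then have "closedin euclidean S"
    using Metric_space.metric_closedin_iff_sequentially_closed[OF M, of S] assms(2)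
    unfolding eq[symmetric] limitin_canonical_iff by blast
  then show ?thesis unfolding closed_closedin .
qed

section \<open>Haar measure: measurability of the group operations and invariance\<close>

locale compact_haar =
  fixes \<mu> :: "'g::topological_ab_group_add measure"
  assumes compact_UNIV: "compact (UNIV :: 'g set)"
    and metrizable: "metrizable_space (euclidean :: 'g topology)"
    and haar: "haar_prob_measure \<mu>"
begin

sublocale prob_space \<mu>
  using haar by (simp add: haar_prob_measure_def)

lemma sets_haar [measurable_cong]: "sets \<mu> = sets borel"
  using haar by (simp add: haar_prob_measure_def)

lemma space_haar [simp]: "space \<mu> = UNIV"
  using sets_eq_imp_space_eq[OF sets_haar] by simp

lemma measurable_continuous_pair:
  assumes "continuous_on UNIV (h :: 'g \<times> 'g \<Rightarrow> 'g)"
  shows "h \<in> borel \<Otimes>\<^sub>M borel \<rightarrow>\<^sub>M borel"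
proof -
  obtain B :: "'g set set" where "countable B" "topological_basis B"
    using compact_metrizable_countable_basis[OF compact_UNIV metrizable] .
  then show ?thesis using assms by (intro borel_measurable_continuous_pair)
qed

lemma measurable_add [measurable]:
  assumes [measurable]: "f \<in> M \<rightarrow>\<^sub>M borel" "g \<in> M \<rightarrow>\<^sub>M borel"
  shows "(\<lambda>x. f x + g x :: 'g) \<in> M \<rightarrow>\<^sub>M borel"
proof -
  have [measurable]: "(\<lambda>z. fst z + snd z :: 'g) \<in> borel \<Otimes>\<^sub>M borel \<rightarrow>\<^sub>M borel"
    by (intro measurable_continuous_pair continuous_intros)
  have "(\<lambda>x. (\<lambda>z. fst z + snd z) (f x, g x)) \<in> M \<rightarrow>\<^sub>M borel" by measurable
  then show ?thesis by simp
qed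

lemma measurable_diff [measurable]:
  assumes [measurable]: "f \<in> M \<rightarrow>\<^sub>M borel" "g \<in> M \<rightarrow>\<^sub>M borel"
  shows "(\<lambda>x. f x - g x :: 'g) \<in> M \<rightarrow>\<^sub>M borel"
proof -
  have [measurable]: "(\<lambda>z. fst z - snd z :: 'g) \<in> borel \<Otimes>\<^sub>M borel \<rightarrow>\<^sub>M borel"
    by (intro measurable_continuous_pair continuous_intros)
  have "(\<lambda>x. (\<lambda>z. fst z - snd z) (f x, g x)) \<in> M \<rightarrow>\<^sub>M borel" by measurable
  then show ?thesis by simp
qed

lemma distr_haar_translate: "distr \<mu> borel (\<lambda>x. x + a) = \<mu>"
  using haar by (simp add: haar_prob_measure_def add.commute[of _ a])

lemma nn_integral_translate:
  assumes [measurable]: "f \<in> borel_measurable borel"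
  shows "(\<integral>\<^sup>+ x. f (x + a) \<partial>\<mu>) = (\<integral>\<^sup>+ x. f x \<partial>\<mu>)"
  by (subst (2) distr_haar_translate[of a, symmetric]) (simp add: nn_integral_distr)

lemma emeasure_haar_translate:
  assumes [measurable]: "A \<in> sets borel"
  shows "emeasure \<mu> {x. x + a \<in> A} = emeasure \<mu> A"
  by (subst (2) distr_haar_translate[of a, symmetric]) (simp add: emeasure_distr vimage_def)

text \<open>Invariance of \<mu> justifies the substitution \<open>z = x + a\<close>.\<close>

lemma distr_translate_density:
  assumes [measurable]: "f \<in> borel_measurable borel"
  shows "distr (density \<mu> f) borel (\<lambda>x. x + a) = density \<mu> (\<lambda>z. f (z - a))"
proof (rule measure_eqI)
  fix A assume "A \<in> sets (distr (density \<mu> f) borel (\<lambda>x. x + a))"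
  then have [measurable]: "A \<in> sets borel" by simp
  have "emeasure (distr (density \<mu> f) borel (\<lambda>x. x + a)) A
      = (\<integral>\<^sup>+ x. indicator A x \<partial>distr (density \<mu> f) borel (\<lambda>x. x + a))" by simp
  also have "\<dots> = (\<integral>\<^sup>+ x. f x * indicator A (x + a) \<partial>\<mu>)"
    by (subst nn_integral_distr) (simp_all add: nn_integral_density)
  also have "\<dots> = (\<integral>\<^sup>+ x. (\<lambda>z. f (z - a) * indicator A z) (x + a) \<partial>\<mu>)" by simp
  also have "\<dots> = (\<integral>\<^sup>+ z. f (z - a) * indicator A z \<partial>\<mu>)" by (rule nn_integral_translate) measurable
  finally show "emeasure (distr (density \<mu> f) borel (\<lambda>x. x + a)) A = emeasure (density \<mu> (\<lambda>z. f (z - a))) A"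
    by (simp add: emeasure_density)
qed (simp add: sets_haar)

section \<open>Convolution of a density with a law\<close>

text \<open>For fixed \<open>y\<close> substitute \<open>z = x + y\<close>, then exchange the
  integrals by Tonelli.\<close>

lemma distr_add_density:
  assumes [measurable]: "f \<in> borel_measurable borel"
    and "prob_space (density \<mu> f)" and "prob_space q" and q [measurable_cong]: "sets q = sets borel"
  shows "distr (density \<mu> f \<Otimes>\<^sub>M q) borel (\<lambda>(x, y). x + y) = density \<mu> (\<lambda>z. \<integral>\<^sup>+ y. f (z - y) \<partial>q)"
proof (rule measure_eqI)
  interpret q: prob_space q by fact
  interpret f: prob_space "density \<mu> f" by fact
  interpret fq: pair_sigma_finite "density \<mu> f" q ..
  interpret \<mu>q: pair_sigma_finite \<mu> q ..
  fix A assume "A \<in> sets (distr (density \<mu> f \<Otimes>\<^sub>M q) borel (\<lambda>(x, y). x + y))"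
  then have [measurable]: "A \<in> sets borel" by simp
  have "emeasure (distr (density \<mu> f \<Otimes>\<^sub>M q) borel (\<lambda>(x, y). x + y)) A
      = (\<integral>\<^sup>+ w. indicator A w \<partial>distr (density \<mu> f \<Otimes>\<^sub>M q) borel (\<lambda>(x, y). x + y))"
    by simp
  also have "\<dots> = (\<integral>\<^sup>+ w. indicator A (fst w + snd w) \<partial>(density \<mu> f \<Otimes>\<^sub>M q))"
    by (subst nn_integral_distr) (simp_all add: case_prod_beta)
  also have "\<dots> = (\<integral>\<^sup>+ y. \<integral>\<^sup>+ x. indicator A (x + y) \<partial>density \<mu> f \<partial>q)"
    by (subst fq.nn_integral_snd[symmetric]) simp_all
  also have "\<dots> = (\<integral>\<^sup>+ y. \<integral>\<^sup>+ z. f (z - y) * indicator A z \<partial>\<mu> \<partial>q)"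
  proof (rule nn_integral_cong)
    fix y
    have "(\<integral>\<^sup>+ x. indicator A (x + y) \<partial>density \<mu> f)
        = (\<integral>\<^sup>+ x. (\<lambda>z. f (z - y) * indicator A z) (x + y) \<partial>\<mu>)"
      by (subst nn_integral_density) simp_all
    also have "\<dots> = (\<integral>\<^sup>+ z. f (z - y) * indicator A z \<partial>\<mu>)" by (rule nn_integral_translate) measurable
    finally show "(\<integral>\<^sup>+ x. indicator A (x + y) \<partial>density \<mu> f) = (\<integral>\<^sup>+ z. f (z - y) * indicator A z \<partial>\<mu>)" .
  qed
  also have "\<dots> = (\<integral>\<^sup>+ z. \<integral>\<^sup>+ y. f (z - y) * indicator A z \<partial>q \<partial>\<mu>)"
    by (rule \<mu>q.Fubini') measurable
  also have "\<dots> = emeasure (density \<mu> (\<lambda>z. \<integral>\<^sup>+ y. f (z - y) \<partial>q)) A"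
    by (simp add: emeasure_density nn_integral_multc)
  finally show "emeasure (distr (density \<mu> f \<Otimes>\<^sub>M q) borel (\<lambda>(x, y). x + y)) A = \<dots>" .
qed (simp add: sets_haar)

text \<open>Jensen's inequality with defect for \<open>y \<mapsto> f (z - y)\<close> under
  \<open>q\<close>, whose mean is \<open>k z\<close>, integrated over \<open>z\<close>. By
  invariance and since \<open>q\<close> has mass 1, averaging over \<open>y\<close> does not change
  the integral of \<open>ent_fun \<circ> f\<close>.\<close>

lemma nn_integral_ent_fun_convolution:
  fixes f :: "'g \<Rightarrow> real"
  assumes [measurable]: "f \<in> borel_measurable borel" and nonneg: "\<And>x. f x \<ge> 0"
    and "(\<integral>\<^sup>+ x. ennreal (f x) \<partial>\<mu>) = 1"
    and "prob_space q" and q [measurable_cong]: "sets q = sets borel"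
  defines "k \<equiv> \<lambda>z. enn2real (\<integral>\<^sup>+ y. ennreal (f (z - y)) \<partial>q)"
  shows "AE z in \<mu>. (\<integral>\<^sup>+ y. ennreal (f (z - y)) \<partial>q) = ennreal (k z)"
    and "(\<integral>\<^sup>+ x. ennreal (ent_fun (f x)) \<partial>\<mu>) = (\<integral>\<^sup>+ z. ennreal (ent_fun (k z)) \<partial>\<mu>)
      + (\<integral>\<^sup>+ z. \<integral>\<^sup>+ y. (if k z > 0 then ennreal (ent_div (f (z - y)) (k z)) else 0) \<partial>q \<partial>\<mu>)"
proof -
  interpret q: prob_space q by fact
  interpret \<mu>q: pair_sigma_finite \<mu> q ..
  have [measurable]: "k \<in> borel_measurable borel" unfolding k_def by measurable
  have Fubini: "(\<integral>\<^sup>+ z. \<integral>\<^sup>+ y. ennreal (h (f (z - y))) \<partial>q \<partial>\<mu>) = (\<integral>\<^sup>+ x. ennreal (h (f x)) \<partial>\<mu>)"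
    if [measurable]: "h \<in> borel_measurable borel" for h
  proof -
    have "(\<integral>\<^sup>+ z. \<integral>\<^sup>+ y. ennreal (h (f (z - y))) \<partial>q \<partial>\<mu>) = (\<integral>\<^sup>+ y. \<integral>\<^sup>+ z. ennreal (h (f (z - y))) \<partial>\<mu> \<partial>q)"
      by (rule \<mu>q.Fubini'[symmetric]) measurable
    also have "\<dots> = (\<integral>\<^sup>+ y. \<integral>\<^sup>+ x. ennreal (h (f x)) \<partial>\<mu> \<partial>q)"
      using nn_integral_translate[of "\<lambda>x. ennreal (h (f x))" "- y" for y] by simp
    finally show ?thesis by (simp add: q.emeasure_space_1)
  qed
  \<comment> \<open>Total mass 1 makes the mean finite for almost every \<open>z\<close>, so a
    real-valued \<open>k\<close> represents it.\<close>
  have "(\<integral>\<^sup>+ z. \<integral>\<^sup>+ y. ennreal (f (z - y)) \<partial>q \<partial>\<mu>) \<noteq> \<infinity>"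
    using Fubini[of "\<lambda>x. x"] assms(3) by simp
  then have "AE z in \<mu>. (\<integral>\<^sup>+ y. ennreal (f (z - y)) \<partial>q) \<noteq> \<infinity>"
    by (intro nn_integral_PInf_AE) measurable
  then show ae: "AE z in \<mu>. (\<integral>\<^sup>+ y. ennreal (f (z - y)) \<partial>q) = ennreal (k z)"
    by eventually_elim (simp add: k_def less_top)
  have "(\<integral>\<^sup>+ x. ennreal (ent_fun (f x)) \<partial>\<mu>) = (\<integral>\<^sup>+ z. \<integral>\<^sup>+ y. ennreal (ent_fun (f (z - y))) \<partial>q \<partial>\<mu>)"
    by (rule Fubini[symmetric]) measurable
  also have "\<dots> = (\<integral>\<^sup>+ z. ennreal (ent_fun (k z))
      + (\<integral>\<^sup>+ y. (if k z > 0 then ennreal (ent_div (f (z - y)) (k z)) else 0) \<partial>q) \<partial>\<mu>)"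
    using ae
  proof (intro nn_integral_cong_AE, eventually_elim)
    case (elim z)
    show ?case using elim nonneg assms(4)
      by (intro nn_integral_ent_fun) (auto simp: k_def)
  qed
  also have "\<dots> = (\<integral>\<^sup>+ z. ennreal (ent_fun (k z)) \<partial>\<mu>)
      + (\<integral>\<^sup>+ z. \<integral>\<^sup>+ y. (if k z > 0 then ennreal (ent_div (f (z - y)) (k z)) else 0) \<partial>q \<partial>\<mu>)"
    by (rule nn_integral_add) measurable
  finally show "(\<integral>\<^sup>+ x. ennreal (ent_fun (f x)) \<partial>\<mu>) = \<dots>" .
qed

section \<open>Stabilizers of laws under translation\<close>

definition stabilizer :: "'g measure \<Rightarrow> 'g set" where
  "stabilizer p = {a. distr p borel (\<lambda>x. x + a) = p}"

lemma distr_translate_translate: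
  assumes [measurable_cong]: "sets p = sets borel"
  shows "distr (distr p borel (\<lambda>x. x + a)) borel (\<lambda>x. x + b) = distr p borel (\<lambda>x :: 'g. x + (a + b))"
  by (subst distr_distr) (simp_all add: comp_def add.assoc)

lemma distr_translate_0:
  assumes "sets p = sets borel"
  shows "distr p borel (\<lambda>x :: 'g. x + 0) = p"
  using distr_id2[OF assms[symmetric]] by simp

text \<open>In the case of equality this puts differences of values of \<open>Y\<close> into the
  stabilizer of the law of \<open>X\<close>.\<close>

lemma translate_eq_imp_stabilizer:
  assumes "sets p = sets borel"
    and "distr p borel (\<lambda>x. x + a) = distr p borel (\<lambda>x. x + b)"
  shows "a - b \<in> stabilizer p"
proof -
  have "distr (distr p borel (\<lambda>x. x + a)) borel (\<lambda>x. x + (- b))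
      = distr (distr p borel (\<lambda>x. x + b)) borel (\<lambda>x. x + (- b))"
    using assms(2) by simp
  then show ?thesis
    unfolding distr_translate_translate[OF assms(1)] stabilizer_def
    using distr_translate_0[OF assms(1)] by simp
qed

lemma add_subgroup_stabilizer:
  assumes "sets p = sets borel"
  shows "add_subgroup (stabilizer p)"
  unfolding add_subgroup_def
proof (intro conjI ballI)
  show "0 \<in> stabilizer p" using distr_translate_0[OF assms] by (simp add: stabilizer_def)
  fix x assume x: "x \<in> stabilizer p"
  then show "- x \<in> stabilizer p"
    using translate_eq_imp_stabilizer[OF assms, of 0 x] distr_translate_0[OF assms]
    by (simp add: stabilizer_def)
  fix y assume "y \<in> stabilizer p"
  then show "x + y \<in> stabilizer p"
    using x distr_translate_translate[OF assms, of x y] by (simp add: stabilizer_def)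
qed

text \<open>Fatou's lemma: if \<open>x + a \<in> U\<close> then \<open>x + \<sigma> n \<in> U\<close> for all large \<open>n\<close>.\<close>

lemma emeasure_translate_limit_le:
  assumes p [measurable_cong]: "sets p = sets borel"
    and \<sigma>: "\<And>n. \<sigma> n \<in> stabilizer p" "\<sigma> \<longlonglongrightarrow> a" and U: "open U"
  shows "emeasure p {x. x + a \<in> U} \<le> emeasure p U"
proof -
  have sp: "space p = UNIV" using sets_eq_imp_space_eq[OF p] by simp
  have [measurable]: "U \<in> sets borel" using U by simp
  have eq: "(\<integral>\<^sup>+ x. indicator U (x + b) \<partial>p) = emeasure (distr p borel (\<lambda>x. x + b)) U" for b
  proof -
    have "(\<integral>\<^sup>+ x. indicator U (x + b) \<partial>p) = (\<integral>\<^sup>+ x. indicator U x \<partial>distr p borel (\<lambda>x. x + b))"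
      by (subst nn_integral_distr) simp_all
    then show ?thesis by simp
  qed
  have "emeasure p {x. x + a \<in> U} = emeasure (distr p borel (\<lambda>x. x + a)) U"
    by (simp add: emeasure_distr vimage_def sp)
  also have "\<dots> = (\<integral>\<^sup>+ x. indicator U (x + a) \<partial>p)" by (simp add: eq)
  also have "\<dots> \<le> (\<integral>\<^sup>+ x. liminf (\<lambda>n. indicator U (x + \<sigma> n)) \<partial>p)"
  proof (rule nn_integral_mono)
    fix x
    show "(indicator U (x + a) :: ennreal) \<le> liminf (\<lambda>n. indicator U (x + \<sigma> n))"
    proof (cases "x + a \<in> U")
      case True
      have "(\<lambda>n. x + \<sigma> n) \<longlonglongrightarrow> x + a" using \<sigma>(2) by (intro tendsto_intros)
      then have "eventually (\<lambda>n. x + \<sigma> n \<in> U) sequentially"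
        using U True by (rule topological_tendstoD)
      then show ?thesis using True
        by (intro Liminf_bounded) (auto elim!: eventually_mono)
    qed simp
  qed
  also have "\<dots> \<le> liminf (\<lambda>n. \<integral>\<^sup>+ x. indicator U (x + \<sigma> n) \<partial>p)"
    by (rule nn_integral_liminf) measurable
  also have "\<dots> = emeasure p U"
    using \<sigma>(1) by (simp add: eq stabilizer_def Liminf_const)
  finally show ?thesis .
qed

text \<open>The limit estimate for \<open>\<sigma>\<close> and for its negative gives equality on
  open sets, which are stable under intersection and generate the Borel sets.\<close>

lemma closed_stabilizer:
  assumes "prob_space p" and p [measurable_cong]: "sets p = sets borel"
  shows "closed (stabilizer p)"
proof (rule metrizable_sequentially_closed[OF metrizable])
  interpret p: prob_space p by fact
  have sp: "space p = UNIV" using sets_eq_imp_space_eq[OF p] by simp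
  fix \<sigma> a assume \<sigma>: "\<And>n. \<sigma> n \<in> stabilizer p" "\<sigma> \<longlonglongrightarrow> a"
  have emb: "emeasure (distr p borel (\<lambda>x. x + a)) U = emeasure p {x. x + a \<in> U}" if "open U" for U
    using that by (subst emeasure_distr) (auto simp: vimage_def sp)
  have "emeasure (distr p borel (\<lambda>x. x + a)) U = emeasure p U" if U: "open U" for U
  proof (rule antisym)
    show "emeasure (distr p borel (\<lambda>x. x + a)) U \<le> emeasure p U"
      unfolding emb[OF U] using \<sigma> U by (rule emeasure_translate_limit_le[OF p])
    \<comment> \<open>For the reverse inequality the estimate is applied with limit
      \<open>- a\<close> to the open set of all \<open>x\<close> with
      \<open>x + a \<in> U\<close>.\<close>
    have "(\<lambda>n. - \<sigma> n) \<longlonglongrightarrow> - a" using \<sigma>(2) by (rule tendsto_minus)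
    moreover have "- \<sigma> n \<in> stabilizer p" for n
      using add_subgroup_stabilizer[OF p] \<sigma>(1) by (simp add: add_subgroup_def)
    moreover have "open {x. x + a \<in> U}"
      using open_vimage[OF U, of "\<lambda>x. x + a"] by (simp add: vimage_def continuous_intros)
    ultimately have "emeasure p {x. x + - a \<in> {x. x + a \<in> U}} \<le> emeasure p {x. x + a \<in> U}"
      by (intro emeasure_translate_limit_le[OF p])
    then show "emeasure p U \<le> emeasure (distr p borel (\<lambda>x. x + a)) U" using emb[OF U] by simp
  qed
  then have "distr p borel (\<lambda>x. x + a) = p"
    by (intro measure_eqI_generator_eq[where E="{S. open S}" and \<Omega>=UNIV and A="\<lambda>_. UNIV"])
      (auto simp: p borel_def Int_stable_def p.emeasure_finite)
  then show "a \<in> stabilizer p" by (simp add: stabilizer_def)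
qed

text \<open>The cosets of \<open>H\<close> are disjoint of equal positive measure, so there are finitely many, and the
  complement of \<open>H\<close> is a finite union of closed cosets.\<close>

lemma open_closed_subgroup:
  assumes H: "add_subgroup H" and "closed H" and pos: "emeasure \<mu> H > 0"
  shows "open H"
proof -
  \<comment> \<open>The translate of \<open>H\<close> by \<open>- a\<close>, written as a preimage
    so that continuity gives closedness and invariance gives its measure.\<close>
  define coset where "coset a = {x. x + a \<in> H}" for a
  have cl: "closed (coset a)" for a
    using closed_vimage[OF \<open>closed H\<close>, of "\<lambda>x. x + a"] by (simp add: coset_def vimage_def continuous_intros)
  have [measurable]: "H \<in> sets borel" using \<open>closed H\<close> by simp
  have m: "measure \<mu> (coset a) = measure \<mu> H" for a
    using emeasure_haar_translate[of H a] by (simp add: coset_def measure_def)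
  have disj: "coset a = coset b" if "x \<in> coset a" "x \<in> coset b" for a b x
  proof -
    \<comment> \<open>A common point \<open>x\<close> gives
      \<open>a - b = (x + a) - (x + b)\<close>, a difference of elements of
      \<open>H\<close>.\<close>
    have ab: "a - b \<in> H" "b - a \<in> H"
      using that H unfolding coset_def add_subgroup_def
      by (metis add_diff_cancel_left diff_conv_add_uminus mem_Collect_eq)+
    have "y + a \<in> H \<longleftrightarrow> y + b \<in> H" for y
      using ab H unfolding add_subgroup_def by (metis add.assoc diff_add_cancel add.commute)
    then show ?thesis by (auto simp: coset_def)
  qed
  have "finite (range coset)"
  proof (rule ccontr)
    have "measure \<mu> H > 0" using pos by (simp add: emeasure_eq_measure)
    \<comment> \<open>With this \<open>n\<close>, the union of \<open>n\<close> disjoint cosets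
      would have measure above 1.\<close>
    then obtain n where n: "1 < real n * measure \<mu> H" using reals_Archimedean3 by blast
    assume "infinite (range coset)"
    then obtain C where C: "C \<subseteq> range coset" "finite C" "card C = n"
      using infinite_arbitrarily_large by blast
    have "c \<in> sets borel" if "c \<in> C" for c using that C(1) cl by auto
    moreover have "c \<inter> c' = {}" if "c \<in> C" "c' \<in> C" "c \<noteq> c'" for c c'
      using that C(1) disj by blast
    ultimately have "measure \<mu> (\<Union>c\<in>C. c) = (\<Sum>c\<in>C. measure \<mu> c)"
      using C(2) by (intro finite_measure_finite_Union) (auto simp: sets_haar disjoint_family_on_def)
    also have "\<dots> = (\<Sum>c\<in>C. measure \<mu> H)" using C m by (intro sum.cong) auto
    finally show False using n C prob_le_1[of "\<Union>c\<in>C. c"] by simp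
  qed
  then have "closed (\<Union>c\<in>range coset - {coset 0}. c)" using cl by (intro closed_UN) auto
  moreover have "(\<Union>c\<in>range coset - {coset 0}. c) = - coset 0"
  proof -
    have "x \<in> coset (- x)" for x using H by (simp add: coset_def add_subgroup_def)
    then show ?thesis using disj by blast
  qed
  moreover have "coset 0 = H" by (simp add: coset_def)
  ultimately show "open H" by (simp add: closed_def)
qed

text \<open>Uniqueness of Haar measure: the double integral of \<open>indicator A (x + y)\<close>
  under \<open>p\<close> and \<mu> is \<open>emeasure p A\<close> by invariance of \<open>p\<close>
  and \<open>emeasure \<mu> A\<close> by invariance of \<mu>.\<close>

lemma stabilizer_UNIV_imp_haar:
  assumes "prob_space p" and p [measurable_cong]: "sets p = sets borel" and "stabilizer p = UNIV"
  shows "p = \<mu>"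
proof (rule measure_eqI)
  interpret p: prob_space p by fact
  interpret p\<mu>: pair_sigma_finite p \<mu> ..
  have sp: "space p = UNIV" using sets_eq_imp_space_eq[OF p] by simp
  fix A assume "A \<in> sets p"
  then have [measurable]: "A \<in> sets borel" by (simp add: p)
  have "(\<integral>\<^sup>+ x. indicator A (x + y) \<partial>p) = emeasure p A" for y
  proof -
    have "(\<integral>\<^sup>+ x. indicator A (x + y) \<partial>p) = (\<integral>\<^sup>+ x. indicator A x \<partial>distr p borel (\<lambda>x. x + y))"
      by (subst nn_integral_distr) simp_all
    also have "distr p borel (\<lambda>x. x + y) = p" using assms(3) by (auto simp: stabilizer_def)
    finally show ?thesis by (simp add: p)
  qed
  then have "emeasure p A = (\<integral>\<^sup>+ y. \<integral>\<^sup>+ x. indicator A (x + y) \<partial>p \<partial>\<mu>)"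
    by (simp add: emeasure_space_1 del: space_haar)
  also have "\<dots> = (\<integral>\<^sup>+ x. \<integral>\<^sup>+ y. indicator A (y + x) \<partial>\<mu> \<partial>p)"
    by (subst p\<mu>.Fubini') (simp_all add: add.commute)
  also have "\<dots> = (\<integral>\<^sup>+ x. emeasure \<mu> A \<partial>p)"
    by (subst nn_integral_translate) (simp_all add: sets_haar)
  also have "\<dots> = emeasure \<mu> A" by (simp add: p.emeasure_space_1)
  finally show "emeasure p A = emeasure \<mu> A" .
qed (simp add: p sets_haar)

end

section \<open>Entropy of sums of independent variables\<close>

lemma (in prob_space) indep_var_commute:
  assumes "indep_var S X T Y"
  shows "indep_var T Y S X"
proof -
  have "indep_set B A" if "indep_set A B" for A B
    using that unfolding indep_sets2_eq by (metis Int_commute mult.commute)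
  then show ?thesis using assms unfolding indep_var_eq by blast
qed

context compact_haar
begin

lemma haar_entropy_le_0:
  assumes "prob_space P" "X \<in> P \<rightarrow>\<^sub>M borel"
  shows "haar_entropy \<mu> P X \<le> 0"
proof (cases "haar_entropy \<mu> P X > - \<infinity>")
  case True
  obtain f :: "'g \<Rightarrow> real" where "f \<in> borel_measurable \<mu>" "\<And>x. f x \<ge> 0"
    "distr P borel X = density \<mu> (\<lambda>x. ennreal (f x))"
    using haar_entropy_finite_density[OF prob_space_axioms assms True] by blast
  with assms show ?thesis
    using haar_entropy_density[OF prob_space_axioms, of f P X] by simp
qed simp

text \<open>On the nonnegative reals \<open>ent_fun\<close> vanishes only at 1, so zero entropy
  means density 1 almost everywhere.\<close>

lemma haar_entropy_eq_0_iff: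
  assumes "prob_space P" "X \<in> P \<rightarrow>\<^sub>M borel"
  shows "haar_entropy \<mu> P X = 0 \<longleftrightarrow> haar_uniform \<mu> P X"
proof
  assume 0: "haar_entropy \<mu> P X = 0"
  then obtain f :: "'g \<Rightarrow> real" where f [measurable]: "f \<in> borel_measurable \<mu>" and nonneg: "\<And>x. f x \<ge> 0"
    and eq: "distr P borel X = density \<mu> (\<lambda>x. ennreal (f x))"
    using haar_entropy_finite_density[OF prob_space_axioms assms] by auto
  have "enn2ereal (\<integral>\<^sup>+ x. ennreal (ent_fun (f x)) \<partial>\<mu>) = enn2ereal 0"
    using haar_entropy_density[OF prob_space_axioms f eq nonneg assms] 0
    by (simp add: zero_ennreal.rep_eq)
  then have "(\<integral>\<^sup>+ x. ennreal (ent_fun (f x)) \<partial>\<mu>) = 0"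
    by (simp only: enn2ereal_inject)
  then have "AE x in \<mu>. ennreal (ent_fun (f x)) = 0"
    by (subst (asm) nn_integral_0_iff_AE) auto
  then have "AE x in \<mu>. ennreal (f x) = 1"
  proof eventually_elim
    case (elim x)
    then show ?case
      using ent_fun_nonneg[OF nonneg[of x]] ent_fun_eq_0_iff[OF nonneg[of x]]
      by (simp add: ennreal_eq_0_iff)
  qed
  then have "density \<mu> (\<lambda>x. ennreal (f x)) = density \<mu> (\<lambda>x. 1)"
    by (intro density_cong) auto
  then show "haar_uniform \<mu> P X"
    by (simp add: haar_uniform_def eq density_1)
next
  assume "haar_uniform \<mu> P X"
  then have "distr P borel X = density \<mu> (\<lambda>x. ennreal 1)"
    by (simp add: haar_uniform_def density_1)
  then have "haar_entropy \<mu> P X = - enn2ereal (\<integral>\<^sup>+ x. ennreal (ent_fun 1) \<partial>\<mu>)"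
    by (intro haar_entropy_density prob_space_axioms assms) auto
  then show "haar_entropy \<mu> P X = 0" by (simp add: ent_fun_def zero_ennreal.rep_eq)
qed

text \<open>Shifting a density leaves the integral of \<open>ent_fun\<close> unchanged. This yields
  equality for two deterministic variables.\<close>

lemma haar_entropy_add_deterministic:
  assumes "prob_space P" and [measurable]: "X \<in> P \<rightarrow>\<^sub>M borel" "Y \<in> P \<rightarrow>\<^sub>M borel"
    and fin: "haar_entropy \<mu> P X > - \<infinity>" and "deterministic P Y"
  shows "haar_entropy \<mu> P (\<lambda>w. X w + Y w) = haar_entropy \<mu> P X"
proof -
  obtain c where c: "AE w in P. Y w = c" using assms(5) by (auto simp: deterministic_def)
  obtain f :: "'g \<Rightarrow> real" where f: "f \<in> borel_measurable \<mu>" and nonneg: "\<And>x. f x \<ge> 0"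
    and eq: "distr P borel X = density \<mu> (\<lambda>x. ennreal (f x))"
    using haar_entropy_finite_density[OF prob_space_axioms assms(1,2) fin] by blast
  have [measurable]: "f \<in> borel_measurable borel" using f by measurable
  have "distr P borel (\<lambda>w. X w + Y w) = distr P borel (\<lambda>w. X w + c)"
    using c by (intro distr_cong_AE) auto
  also have "\<dots> = distr (distr P borel X) borel (\<lambda>x. x + c)"
    by (subst distr_distr) (simp_all add: comp_def)
  also have "\<dots> = density \<mu> (\<lambda>z. ennreal (f (z - c)))"
    unfolding eq by (rule distr_translate_density) measurable
  finally have "haar_entropy \<mu> P (\<lambda>w. X w + Y w) = - enn2ereal (\<integral>\<^sup>+ z. ennreal (ent_fun (f (z - c))) \<partial>\<mu>)"
    using nonneg by (intro haar_entropy_density prob_space_axioms assms) auto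
  also have "(\<integral>\<^sup>+ z. ennreal (ent_fun (f (z - c))) \<partial>\<mu>) = (\<integral>\<^sup>+ x. ennreal (ent_fun (f x)) \<partial>\<mu>)"
    using nn_integral_translate[of "\<lambda>x. ennreal (ent_fun (f x))" "- c"] by simp
  also have "- enn2ereal \<dots> = haar_entropy \<mu> P X"
    using haar_entropy_density[OF prob_space_axioms f eq nonneg assms(1,2)] by simp
  finally show ?thesis .
qed

text \<open>The gain in entropy is the integrated Jensen defect. If it vanishes, then for almost
  every \<open>y\<close> the translate by \<open>y\<close> of the law of \<open>X\<close> has the
  density \<open>k\<close> of the sum.\<close>

lemma haar_entropy_add:
  assumes P: "prob_space P" and indep: "prob_space.indep_var P borel X borel Y"
    and fin: "haar_entropy \<mu> P X > - \<infinity>"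
  shows "haar_entropy \<mu> P X \<le> haar_entropy \<mu> P (\<lambda>w. X w + Y w)"
    and "haar_entropy \<mu> P (\<lambda>w. X w + Y w) = haar_entropy \<mu> P X \<Longrightarrow>
      AE y in distr P borel Y.
        distr (distr P borel X) borel (\<lambda>x. x + y) = distr P borel (\<lambda>w. X w + Y w)"
proof -
  interpret P: prob_space P by fact
  have X [measurable]: "X \<in> P \<rightarrow>\<^sub>M borel" and Y [measurable]: "Y \<in> P \<rightarrow>\<^sub>M borel"
    and joint: "distr P borel X \<Otimes>\<^sub>M distr P borel Y = distr P (borel \<Otimes>\<^sub>M borel) (\<lambda>w. (X w, Y w))"
    using indep unfolding P.indep_var_distribution_eq by auto
  define q where "q = distr P borel Y"
  interpret q: prob_space q unfolding q_def by (rule P.prob_space_distr) measurable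
  have q [measurable_cong]: "sets q = sets borel" by (simp add: q_def)
  interpret \<mu>q: pair_sigma_finite \<mu> q ..
  obtain f :: "'g \<Rightarrow> real" where f: "f \<in> borel_measurable \<mu>" and nonneg: "\<And>x. f x \<ge> 0"
    and eq: "distr P borel X = density \<mu> (\<lambda>x. ennreal (f x))"
    and If: "(\<integral>\<^sup>+ x. ennreal (ent_fun (f x)) \<partial>\<mu>) < \<infinity>"
    using haar_entropy_finite_density[OF prob_space_axioms P X fin] by blast
  have [measurable]: "f \<in> borel_measurable borel" using f by measurable
  have dens: "prob_space (density \<mu> (\<lambda>x. ennreal (f x)))"
    unfolding eq[symmetric] by (rule P.prob_space_distr) measurable
  have one: "(\<integral>\<^sup>+ x. ennreal (f x) \<partial>\<mu>) = 1"
    using prob_space.emeasure_space_1[OF dens] by (simp add: emeasure_density)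
  define k where "k z = enn2real (\<integral>\<^sup>+ y. ennreal (f (z - y)) \<partial>q)" for z
  have [measurable]: "k \<in> borel_measurable borel" unfolding k_def by measurable
  note conv = nn_integral_ent_fun_convolution[OF \<open>f \<in> borel_measurable borel\<close> nonneg one
      q.prob_space_axioms q, folded k_def]
  have "distr P borel (\<lambda>w. X w + Y w) = distr (distr P borel X \<Otimes>\<^sub>M distr P borel Y) borel (\<lambda>(x, y). x + y)"
    unfolding joint by (subst distr_distr) (simp_all add: comp_def case_prod_beta)
  also have "\<dots> = density \<mu> (\<lambda>z. \<integral>\<^sup>+ y. ennreal (f (z - y)) \<partial>q)"
    unfolding eq q_def[symmetric]
    by (rule distr_add_density[OF _ dens q.prob_space_axioms q]) measurable
  also have "\<dots> = density \<mu> (\<lambda>z. ennreal (k z))"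
    using conv(1) by (intro density_cong) auto
  finally have sum: "distr P borel (\<lambda>w. X w + Y w) = density \<mu> (\<lambda>z. ennreal (k z))" .
  let ?I = "\<lambda>f. \<integral>\<^sup>+ x. ennreal (ent_fun (f x)) \<partial>\<mu>"
  let ?B = "\<integral>\<^sup>+ z. \<integral>\<^sup>+ y. (if k z > 0 then ennreal (ent_div (f (z - y)) (k z)) else 0) \<partial>q \<partial>\<mu>"
  have hX: "haar_entropy \<mu> P X = - enn2ereal (?I f)"
    using haar_entropy_density[OF prob_space_axioms f eq nonneg P X] .
  have hXY: "haar_entropy \<mu> P (\<lambda>w. X w + Y w) = - enn2ereal (?I k)"
    using sum by (intro haar_entropy_density prob_space_axioms P) (auto simp: k_def)
  have "?I k \<le> ?I f" unfolding conv(2) by simp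
  then show "haar_entropy \<mu> P X \<le> haar_entropy \<mu> P (\<lambda>w. X w + Y w)"
    by (simp add: hX hXY less_eq_ennreal.rep_eq)
  assume "haar_entropy \<mu> P (\<lambda>w. X w + Y w) = haar_entropy \<mu> P X"
  then have "?I f = ?I k" by (simp add: hX hXY enn2ereal_inject)
  then have "?I k + 0 = ?I k + ?B" using conv(2) by simp
  \<comment> \<open>Cancelling \<open>?I k\<close> requires it to be finite; it equals
    \<open>?I f\<close>, which is finite with the entropy of \<open>X\<close>.\<close>
  then have "?B = 0"
    unfolding ennreal_add_left_cancel using If \<open>?I f = ?I k\<close> by auto
  then have "AE z in \<mu>. (\<integral>\<^sup>+ y. (if k z > 0 then ennreal (ent_div (f (z - y)) (k z)) else 0) \<partial>q) = 0"
    by (subst (asm) nn_integral_0_iff_AE) auto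
  with conv(1) have "AE z in \<mu>. AE y in q. f (z - y) = k z"
  proof eventually_elim
    case (elim z)
    then show ?case using nonneg by (intro nn_integral_ent_div_eq_0) (auto simp: k_def)
  qed
  \<comment> \<open>Exchanging the quantifiers fixes \<open>y\<close> first, so that two densities
    in \<open>z\<close> are compared.\<close>
  then have "AE y in q. AE z in \<mu>. f (z - y) = k z"
    by (subst (asm) \<mu>q.AE_commute) auto
  then have "AE y in q. distr (distr P borel X) borel (\<lambda>x. x + y) = distr P borel (\<lambda>w. X w + Y w)"
  proof eventually_elim
    case (elim y)
    have "distr (distr P borel X) borel (\<lambda>x. x + y) = density \<mu> (\<lambda>z. ennreal (f (z - y)))"
      unfolding eq by (rule distr_translate_density) measurable
    also have "\<dots> = density \<mu> (\<lambda>z. ennreal (k z))"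
      using elim by (intro density_cong) auto
    finally show ?case unfolding sum .
  qed
  then show "AE y in distr P borel Y.
    distr (distr P borel X) borel (\<lambda>x. x + y) = distr P borel (\<lambda>w. X w + Y w)"
    unfolding q_def .
qed

text \<open>Recording disconnectedness with the deterministic alternative is what rules it out for
  connected groups.\<close>

lemma haar_entropy_add_eq:
  assumes sub: "\<And>H :: 'g set. add_subgroup H \<Longrightarrow> open H \<Longrightarrow> H = UNIV \<or> H = {0}"
    and P: "prob_space P" and indep: "prob_space.indep_var P borel X borel Y"
    and finX: "haar_entropy \<mu> P X > - \<infinity>" and finY: "haar_entropy \<mu> P Y > - \<infinity>"
    and eq: "haar_entropy \<mu> P (\<lambda>w. X w + Y w) = haar_entropy \<mu> P X"
  shows "haar_uniform \<mu> P X \<or> deterministic P Y \<and> \<not> connected (UNIV :: 'g set)"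
proof -
  interpret P: prob_space P by fact
  have X [measurable]: "X \<in> P \<rightarrow>\<^sub>M borel" and Y [measurable]: "Y \<in> P \<rightarrow>\<^sub>M borel"
    using indep unfolding P.indep_var_distribution_eq by auto
  define p q where "p = distr P borel X" and "q = distr P borel Y"
  interpret p: prob_space p unfolding p_def by (rule P.prob_space_distr) measurable
  interpret q: prob_space q unfolding q_def by (rule P.prob_space_distr) measurable
  have p: "sets p = sets borel" by (simp add: p_def)
  define H where "H = stabilizer p"
  have H: "add_subgroup H" "closed H"
    unfolding H_def using p by (auto intro: add_subgroup_stabilizer closed_stabilizer p.prob_space_axioms)
  have ae: "AE y in q. distr p borel (\<lambda>x. x + y) = distr P borel (\<lambda>w. X w + Y w)"
    unfolding p_def q_def using haar_entropy_add(2)[OF P indep finX eq] .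
  \<comment> \<open>Any typical value of \<open>Y\<close> serves as base point: the other typical
    values differ from \<open>y0\<close> by elements of \<open>H\<close>.\<close>
  then obtain y0 where y0: "distr p borel (\<lambda>x. x + y0) = distr P borel (\<lambda>w. X w + Y w)"
    using q.AE_contr by blast
  from ae have aeH: "AE y in q. y + - y0 \<in> H"
  proof eventually_elim
    case (elim y)
    then show ?case using translate_eq_imp_stabilizer[OF p, of y y0] y0 by (simp add: H_def)
  qed
  \<comment> \<open>If \<open>H\<close> were null, so would be its translate by \<open>y0\<close>;
    but \<open>q\<close> is concentrated there and absolutely continuous.\<close>
  have "emeasure \<mu> H > 0"
  proof (rule ccontr)
    assume "\<not> emeasure \<mu> H > 0"
    moreover have [measurable]: "H \<in> sets borel" using H(2) by simp
    ultimately have "emeasure \<mu> {y. y + - y0 \<in> H} = 0"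
      by (subst emeasure_haar_translate) auto
    moreover have "{y. y + - y0 \<in> H} \<in> sets borel"
      using measurable_sets[of "\<lambda>y. y + - y0" borel borel H] by (simp add: vimage_def)
    ultimately have null: "{y. y + - y0 \<in> H} \<in> null_sets \<mu>" by (simp add: null_sets_def sets_haar)
    obtain g :: "'g \<Rightarrow> real" where g: "g \<in> borel_measurable \<mu>" "q = density \<mu> (\<lambda>x. ennreal (g x))"
      using haar_entropy_finite_density[OF prob_space_axioms P Y finY] unfolding q_def by metis
    then have "absolutely_continuous \<mu> q" by (auto intro!: absolutely_continuousI_density)
    then have "{y. y + - y0 \<in> H} \<in> null_sets q" using null by (auto simp: absolutely_continuous_def)
    then have "AE y in q. \<not> y + - y0 \<in> H" using AE_not_in by fastforce
    then show False using aeH q.AE_contr by blast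
  qed
  then have "open H" by (rule open_closed_subgroup[OF H])
  \<comment> \<open>The trivial group falls under the first case, so in the second
    \<open>{0}\<close> is a proper clopen subset.\<close>
  with sub[OF H(1)] consider "H = UNIV" | "H = {0}" "H \<noteq> UNIV" by blast
  then show ?thesis
  proof cases
    case 1
    then have "p = \<mu>" unfolding H_def using p by (intro stabilizer_UNIV_imp_haar p.prob_space_axioms)
    then show ?thesis by (simp add: haar_uniform_def p_def)
  next
    case 2
    then have "AE y in distr P borel Y. y = y0" using aeH unfolding q_def by simp
    then have "AE w in P. Y w = y0" by (rule AE_distrD[OF Y])
    moreover have "\<not> connected (UNIV :: 'g set)"
      using H(2) \<open>open H\<close> 2 unfolding connected_clopen by (metis insert_not_empty open_openin closed_closedin subtopology_UNIV)
    ultimately show ?thesis by (auto simp: deterministic_def)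
  qed
qed

end

theorem theorem1p1:
  fixes \<mu> :: "'g::topological_ab_group_add measure"
    and P :: "'w measure"
    and X Y :: "'w \<Rightarrow> 'g"
  assumes "compact (UNIV :: 'g set)"
    and "metrizable_space (euclidean :: 'g topology)"
    and "\<And>H :: 'g set. add_subgroup H \<Longrightarrow> open H \<Longrightarrow> H = UNIV \<or> H = {0}"
    and "haar_prob_measure \<mu>"
    and "prob_space P"
    and "prob_space.indep_var P borel X borel Y"
    and "haar_entropy \<mu> P X > - \<infinity>"
    and "haar_entropy \<mu> P Y > - \<infinity>"
  shows "let D = haar_entropy \<mu> P (\<lambda>w. X w + Y w)
                 - ereal (1 / 2) * haar_entropy \<mu> P X
                 - ereal (1 / 2) * haar_entropy \<mu> P Y
         in D \<ge> 0
          \<and> (connected (UNIV :: 'g set) \<longrightarrow>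
               (D = 0 \<longleftrightarrow> haar_uniform \<mu> P X \<and> haar_uniform \<mu> P Y))
          \<and> (finite (UNIV :: 'g set) \<longrightarrow>
               (D = 0 \<longleftrightarrow> (haar_uniform \<mu> P X \<and> haar_uniform \<mu> P Y)
                          \<or> (deterministic P X \<and> deterministic P Y)))"
proof -
  interpret compact_haar \<mu> using assms(1,2,4) by unfold_locales
  interpret P: prob_space P by fact
  have X [measurable]: "X \<in> P \<rightarrow>\<^sub>M borel" and Y [measurable]: "Y \<in> P \<rightarrow>\<^sub>M borel"
    using assms(6) unfolding P.indep_var_distribution_eq by auto
  \<comment> \<open>Every result on \<open>X\<close> is also applied with the two variables
    exchanged.\<close>
  have indep': "P.indep_var borel Y borel X" using assms(6) by (rule P.indep_var_commute)
  have comm: "(\<lambda>w. Y w + X w) = (\<lambda>w. X w + Y w)" by (simp add: add.commute)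
  define a b c where "a = haar_entropy \<mu> P X" and "b = haar_entropy \<mu> P Y"
    and "c = haar_entropy \<mu> P (\<lambda>w. X w + Y w)"
  have ac: "a \<le> c" and bc: "b \<le> c"
    using haar_entropy_add(1)[OF assms(5,6,7)] haar_entropy_add(1)[OF assms(5) indep' assms(8)]
    by (simp_all add: a_def b_def c_def comm)
  have le0: "a \<le> 0" "b \<le> 0" "c \<le> 0"
    unfolding a_def b_def c_def by (auto intro!: haar_entropy_le_0 assms(5))
  have fin: "a > - \<infinity>" "b > - \<infinity>" using assms(7,8) by (simp_all add: a_def b_def)
  \<comment> \<open>The difference is half of \<open>(c - a) + (c - b)\<close>, a sum of finite
    nonnegative terms.\<close>
  have D: "c - ereal (1 / 2) * a - ereal (1 / 2) * b \<ge> 0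
      \<and> (c - ereal (1 / 2) * a - ereal (1 / 2) * b = 0 \<longleftrightarrow> c = a \<and> c = b)"
    using ac bc le0 fin by (cases a; cases b; cases c) auto
  have uniform_iff: "haar_uniform \<mu> P X \<longleftrightarrow> a = 0" "haar_uniform \<mu> P Y \<longleftrightarrow> b = 0"
    using haar_entropy_eq_0_iff[OF assms(5) X] haar_entropy_eq_0_iff[OF assms(5) Y]
    by (simp_all add: a_def b_def)
  have uniform: "c = a \<and> c = b" if "a = 0" "b = 0"
    using that ac le0 by auto
  have det: "c = a \<and> c = b" if "deterministic P X" "deterministic P Y"
    using haar_entropy_add_deterministic[OF assms(5) X Y assms(7) that(2)]
      haar_entropy_add_deterministic[OF assms(5) Y X assms(8) that(1)]
    by (simp add: a_def b_def c_def comm)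
  have eqX: "a = 0 \<or> deterministic P Y \<and> \<not> connected (UNIV :: 'g set)" if "c = a"
    using haar_entropy_add_eq[OF assms(3,5-8)] that unfolding uniform_iff by (simp add: a_def c_def)
  have eqY: "b = 0 \<or> deterministic P X \<and> \<not> connected (UNIV :: 'g set)" if "c = b"
    using haar_entropy_add_eq[OF assms(3,5) indep' assms(8,7)] that unfolding uniform_iff comm
    by (simp add: b_def c_def)
  \<comment> \<open>Equality gives \<open>a = b = c\<close>. If this value is 0, both variables are
    uniform; otherwise \<open>eqX\<close> and \<open>eqY\<close> make both deterministic and the
    group disconnected.\<close>
  show ?thesis
    unfolding Let_def a_def[symmetric] b_def[symmetric] c_def[symmetric] uniform_iff
    using D uniform det eqX eqY by metis
qed

end
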